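(* Let $F$ be the IFS fractal generated by a planar IFS $\mathcal{T}=\{T_1,\dots,T_n\}$, and let $\tau\in\mathbb{C}\setminus\{0\}$. (1) If $a\in\mathcal{A}_{fin}$ and $a<\mathrm{adr}\,M(\tau)$, then $M(\tau)=T_a\big(M(e^{-\nu(a) i}\tau)\big)$. (2) If $b,x\in\mathcal{A}_{fin}$ satisfy $bx<\mathrm{adr}\,M(\tau)$, $\nu(x)=0$, $x\neq 0$, then $M(\tau)=\{T_b(p_x)\}$. (3) If $e\in\mathrm{Ext}(F)$ and $b,x\in\mathcal{A}_{fin}$ satisfy $bx<\mathrm{adr}(e)$, $\nu(x)=0$, $x\ne 0$, then $\mathrm{adr}(e)=b\bar{x}$.
   Context: IFS: $T_k(z)=p_k+\varphi_k(z-p_k)$ on $\mathbb{C}$, $k\in\mathcal{N}=\{1,\dots,n\}$, with $p_k\in\mathbb{C}$, $\varphi_k=\lambda_k e^{\vartheta_k i}$, $\lambda_k\in(0,1)$, rotation angle $\vartheta_k\in(-\pi,\pi]$. The IFS fractal $F$ is the unique nonempty compact set with $F=\bigcup_{k}T_k(F)$. Addresses: $\mathcal{A}_{fin}$ is the set of finite words over $\mathcal{N}$, including the empty word, written $0$, of length $|0|=0$; infinite addresses are elements of $\mathcal{N}^{\mathbb{N}}$. For finite $a$, $T_a=T_{a(1)}\circ\dots\circ T_{a(|a|)}$, $T_0=\mathrm{Id}$; for infinite $a$, $T_a$ denotes the point $\lim_m T_{a(1)}\circ\dots\circ T_{a(m)}(z)$, independent of $z$. $ab$ is concatenation and $\bar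 x=xxx\dots$. For finite $a$, $a<b$ means $a$ is a prefix (truncation) of $b$ (equality and $a=0$ allowed). For $x\in\mathcal{A}_{fin}\setminus\{0\}$, $p_x$ is the unique fixed point of $T_x$. For $f\in F$, $\mathrm{adr}(f)$ is the lexicographically smallest infinite address $a$ with $T_a=f$. The value of a finite address is $\nu(a)=\vartheta_{a(1)}+\dots+\vartheta_{a(|a|)} \bmod 2\pi\in[0,2\pi)$, $\nu(0)=0$. $\mathrm{Ext}(S)$, for compact $S\subset\mathbb{C}$, is the set of extreme points (vertices) of the convex hull $\mathrm{Conv}(S)$. For $\tau\in\mathbb{C}\setminus\{0\}$ let $\langle\tau,z\rangle=\mathrm{Re}\,\tau\,\mathrm{Re}\,z+\mathrm{Im}\,\tau\,\mathrm{Im}\,z$, and let $M(\tau)$ be the set of those extremal points of $F$ at which $z\mapsto\langle\tau,z\rangle$ attains its maximum over $F$ (it has one or two elements). $a<\mathrm{adr}\,M(\tau)$ means $a<\mathrm{adr}(f)$ for every $f\in M(\tau)$. *)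

theory Defs
  imports "HOL-Analysis.Analysis" "HOL-Library.Stream" "HOL-Library.Real_Mod"
begin

text \<open>
  An IFS is given by its number \<open>n\<close> of maps and the maps \<open>T k\<close> for \<open>k \<in> {1..n}\<close>; values of
  \<open>T\<close> outside this range are irrelevant. Finite addresses are elements of \<open>lists {1..n}\<close>
  (the empty word is \<open>[]\<close>), infinite addresses are elements of \<open>streams {1..n}\<close>.
  Hence \<open>b @- cycle x\<close> is the word \<open>b\<close> followed by \<open>x\<close> repeated forever.
\<close>

definition ifs_fractal :: "nat \<Rightarrow> (nat \<Rightarrow> complex \<Rightarrow> complex) \<Rightarrow> complex set" where
  "ifs_fractal n T = (THE F. F \<noteq> {} \<and> compact F \<and> F = (\<Union>k\<in>{1..n}. T k ` F))"

definition word_map :: "(nat \<Rightarrow> complex \<Rightarrow> complex) \<Rightarrow> nat list \<Rightarrow> complex \<Rightarrow> complex" where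
  "word_map T a = foldr (\<circ>) (map T a) id"

definition address_point :: "(nat \<Rightarrow> complex \<Rightarrow> complex) \<Rightarrow> nat stream \<Rightarrow> complex" where
  "address_point T a = (THE w. \<forall>z. (\<lambda>m. word_map T (stake m a) z) \<longlonglongrightarrow> w)"

definition word_fixed_point :: "(nat \<Rightarrow> complex \<Rightarrow> complex) \<Rightarrow> nat list \<Rightarrow> complex" where
  "word_fixed_point T x = (THE z. word_map T x z = z)"

definition address_prefix :: "nat list \<Rightarrow> nat stream \<Rightarrow> bool" where
  "address_prefix a s \<longleftrightarrow> (\<exists>t. s = a @- t)"

definition lex_le :: "nat stream \<Rightarrow> nat stream \<Rightarrow> bool" where
  "lex_le a b \<longleftrightarrow> a = b \<or> (\<exists>m. stake m a = stake m b \<and> a !! m < b !! m)"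

definition adr :: "nat \<Rightarrow> (nat \<Rightarrow> complex \<Rightarrow> complex) \<Rightarrow> complex \<Rightarrow> nat stream" where
  "adr n T f = (THE a. a \<in> streams {1..n} \<and> address_point T a = f \<and>
     (\<forall>b\<in>streams {1..n}. address_point T b = f \<longrightarrow> lex_le a b))"

text \<open>\<open>rmod\<close> with modulus \<open>2 * pi\<close> takes values in \<open>{0..<2 * pi}\<close>.\<close>

definition address_value :: "(nat \<Rightarrow> real) \<Rightarrow> nat list \<Rightarrow> real" where
  "address_value \<theta> a = (\<Sum>k\<leftarrow>a. \<theta> k) rmod (2 * pi)"

definition Ext :: "complex set \<Rightarrow> complex set" where
  "Ext S = {e. e extreme_point_of (convex hull S)}"

text \<open>
  The inner product of \<open>complex\<close> as a Euclidean space is \<open>Re \<tau> * Re z + Im \<tau> * Im z\<close>.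
  For compact \<open>F\<close> the points of \<open>Ext F\<close> lie in \<open>F\<close>, so the inequality below says that the
  maximum over \<open>F\<close> is attained at \<open>e\<close>.
\<close>

definition maximizers :: "complex set \<Rightarrow> complex \<Rightarrow> complex set" where
  "maximizers F \<tau> = {e \<in> Ext F. \<forall>z\<in>F. \<tau> \<bullet> z \<le> \<tau> \<bullet> e}"

end

theory Submission
  imports Defs
begin

text \<open>
  Each word map \<open>T\<^sub>a\<close> is an affine similarity: a rotation by the value of \<open>a\<close>, a scaling by a
  positive factor and a translation. So, maximising \<open>\<langle>\<tau>, _\<rangle>\<close> over the piece \<open>T\<^sub>a F\<close> amounts to
  maximising the functional of the backwards rotated direction over \<open>F\<close>, which is
  \<open>maximizers_affine_image\<close>. If the addresses of all maximisers start with \<open>a\<close>, then these maximisers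
  lie in \<open>T\<^sub>a F\<close>, and Krein--Milman shows that \<open>T\<^sub>a F\<close> and \<open>F\<close> have the same maximisers
  (\<open>maximizers_subset_eq\<close>). Both facts together give part (1).

  For parts (2) and (3), let \<open>x\<close> be a nonempty word of value zero. Then \<open>T\<^sub>x\<close> is a contracting homothety
  whose centre \<open>p\<^sub>x\<close> lies in \<open>F\<close>. For \<open>g \<in> F\<close> with \<open>g \<noteq> p\<^sub>x\<close> the point \<open>T\<^sub>x g\<close> lies strictly between
  \<open>p\<^sub>x\<close> and \<open>g\<close>, so \<open>T\<^sub>b (T\<^sub>x g)\<close> is no extreme point. An extreme point whose address starts with \<open>bx\<close>
  is therefore \<open>T\<^sub>b p\<^sub>x\<close> (\<open>extreme_point_with_untwisted_prefix\<close>). This determines the point, whether or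
  not it is exposed. Since a tail of a lexicographically smallest address is itself one
  (\<open>adr_shiftD\<close>), the tails after \<open>b\<close> and after \<open>bx\<close> are both the address of \<open>p\<^sub>x\<close>; so they agree, and
  the tail is periodic.

  The definite descriptions in the definitions of the fractal, of the point of an address and of the
  address of a point need a foundation. A fractal arises as an intersection of nested compact sets
  (\<open>ex_attractor\<close>). In any such set, the point of an address is characterised by lying in all the nested
  pieces of its prefixes (\<open>address_point_iff\<close>), so the fractal is the set of all points of addresses and
  is unique. The lexicographically smallest address of a point is found greedily, choosing at each step
  the smallest index of a piece that contains the current point.
\<close>

section \<open>Maximisers of a linear functional\<close>

lemma Ext_subset: "Ext S \<subseteq> S"
  using extreme_point_of_convex_hull by (auto simp: Ext_def)

lemma maximizers_subset: "maximizers S \<tau> \<subseteq> S"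
  using Ext_subset by (auto simp: maximizers_def)

text \<open>The points at which the maximum is attained form a face of the convex hull. Its extreme points
  are the maximisers, and by Krein--Milman they span the face.\<close>

lemma max_points_in_convex_hull_maximizers:
  assumes "compact S" "z \<in> S" "\<And>w. w \<in> S \<Longrightarrow> \<tau> \<bullet> w \<le> \<tau> \<bullet> z"
  shows "z \<in> convex hull maximizers S \<tau>"
proof -
  define H where "H = (convex hull S) \<inter> {x. \<tau> \<bullet> x = \<tau> \<bullet> z}"
  have "convex hull S \<subseteq> {x. \<tau> \<bullet> x \<le> \<tau> \<bullet> z}"
    by (rule hull_minimal) (use assms(3) convex_halfspace_le in auto)
  then have face: "H face_of (convex hull S)"
    unfolding H_def by (intro face_of_Int_supporting_hyperplane_le) auto
  have "compact H" "convex H"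
    unfolding H_def using assms(1)
    by (auto intro!: compact_Int_closed compact_convex_hull closed_hyperplane
        convex_Int convex_hyperplane)
  then have "H = convex hull {x. x extreme_point_of H}"
    by (rule Krein_Milman_Minkowski)
  moreover have "{x. x extreme_point_of H} \<subseteq> maximizers S \<tau>"
    using extreme_point_of_face[OF face] assms(3)
    by (auto simp: maximizers_def Ext_def H_def)
  moreover have "z \<in> H"
    using assms(2) by (auto simp: H_def hull_inc)
  ultimately show ?thesis
    using hull_mono by blast
qed

lemma maximizers_nonempty:
  assumes "compact S" "S \<noteq> {}"
  shows "maximizers S \<tau> \<noteq> {}"
proof -
  obtain z where "z \<in> S" "\<And>w. w \<in> S \<Longrightarrow> \<tau> \<bullet> w \<le> \<tau> \<bullet> z"
    using continuous_attains_sup[OF assms continuous_on_inner[OF continuous_on_const continuous_on_id]]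
    by blast
  with max_points_in_convex_hull_maximizers[OF assms(1), of z \<tau>] show ?thesis
    by auto
qed

lemma Ext_subset_Ext:
  assumes "S \<subseteq> F" "e \<in> Ext F" "e \<in> S"
  shows "e \<in> Ext S"
  using assms(2) hull_mono[OF assms(1), of convex] hull_inc[OF assms(3), of convex]
  by (auto simp: Ext_def extreme_point_of_def)

text \<open>A maximiser \<open>z\<close> over the subset also attains the maximum over \<open>F\<close>, so it is a convex combination of
  maximisers over \<open>F\<close>. These lie in the subset, where \<open>z\<close> is extreme; so \<open>z\<close> is one of them.\<close>

lemma maximizers_subset_eq:
  assumes "compact F" "F \<noteq> {}" "S \<subseteq> F" "maximizers F \<tau> \<subseteq> S"
  shows "maximizers S \<tau> = maximizers F \<tau>"
proof
  show "maximizers F \<tau> \<subseteq> maximizers S \<tau>"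
    using assms(3,4) Ext_subset_Ext[OF assms(3)] by (auto simp: maximizers_def)
  show "maximizers S \<tau> \<subseteq> maximizers F \<tau>"
  proof
    fix z assume z: "z \<in> maximizers S \<tau>"
    obtain f where f: "f \<in> maximizers F \<tau>"
      using maximizers_nonempty[OF assms(1,2)] by blast
    have "\<tau> \<bullet> w \<le> \<tau> \<bullet> z" if "w \<in> F" for w
    proof -
      have "\<tau> \<bullet> w \<le> \<tau> \<bullet> f" using f that by (auto simp: maximizers_def)
      also have "\<dots> \<le> \<tau> \<bullet> z" using f z assms(4) by (auto simp: maximizers_def)
      finally show ?thesis .
    qed
    moreover have "z \<in> F" using z maximizers_subset assms(3) by blast
    ultimately have "z \<in> convex hull maximizers F \<tau>"
      by (intro max_points_in_convex_hull_maximizers assms)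
    moreover have "z extreme_point_of convex hull S"
      using z by (auto simp: maximizers_def Ext_def)
    ultimately have "z extreme_point_of convex hull maximizers F \<tau>"
      using hull_mono[OF assms(4), of convex] by (auto simp: extreme_point_of_def)
    then show "z \<in> maximizers F \<tau>"
      by (rule extreme_point_of_convex_hull)
  qed
qed

lemma Ext_affine_image:
  fixes c d :: complex
  assumes "c \<noteq> 0"
  shows "Ext ((\<lambda>z. c * z + d) ` S) = (\<lambda>z. c * z + d) ` Ext S"
proof -
  have lin: "linear ((*) c)"
    by (simp add: linear_times)
  have inj: "inj ((*) c)"
    using assms by (simp add: inj_on_def)
  have eq: "(\<lambda>z. c * z + d) ` A = (\<lambda>z. d + z) ` ((*) c ` A)" for A
    by (auto simp: image_image add.commute)
  have "Ext ((*) c ` S) = (*) c ` Ext S"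
  proof -
    have "x extreme_point_of ((*) c ` C) \<longleftrightarrow> x \<in> (*) c ` {y. y extreme_point_of C}" for x C
    proof -
      have "c * y extreme_point_of ((*) c ` C) \<longleftrightarrow> y extreme_point_of C" for y
        using face_of_linear_image[OF lin inj, of "{y}" C] by (simp add: face_of_singleton)
      moreover have "x = c * (x / c)"
        using assms by simp
      ultimately show ?thesis
        using assms by (metis (no_types, lifting) image_iff mem_Collect_eq mult_left_cancel)
    qed
    then show ?thesis
      by (auto simp: Ext_def convex_hull_linear_image[OF lin, symmetric])
  qed
  then show ?thesis
    unfolding eq by (simp add: Ext_def convex_hull_translation extreme_points_of_translation)
qed

lemma inner_mult_left_cnj: "\<tau> \<bullet> (c * z) = (cnj c * \<tau>) \<bullet> (z :: complex)"
  by (simp add: inner_complex_def algebra_simps)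

lemma maximizers_affine_image:
  fixes c d :: complex
  assumes "c \<noteq> 0"
  shows "maximizers ((\<lambda>z. c * z + d) ` S) \<tau> = (\<lambda>z. c * z + d) ` maximizers S (cnj c * \<tau>)"
  by (auto simp: maximizers_def Ext_affine_image[OF assms] inner_add_right inner_mult_left_cnj)

lemma maximizers_scale:
  assumes "r > 0"
  shows "maximizers S (of_real r * \<tau>) = maximizers S \<tau>"
proof -
  have "(of_real r * \<tau>) \<bullet> z = r * (\<tau> \<bullet> z)" for z
    by (simp add: inner_complex_def algebra_simps)
  then show ?thesis
    using assms by (simp add: maximizers_def)
qed

section \<open>Infinite words\<close>

lemma stake_in_lists: "s \<in> streams A \<Longrightarrow> stake m s \<in> lists A"
  by (induction m arbitrary: s) (auto intro: streams_shd streams_stl)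

lemma periodic_stream_eq_cycle:
  assumes "x \<noteq> []" "t = x @- t"
  shows "t = cycle x"
proof -
  have "t !! i = cycle x !! i" for i
  proof (induction i rule: less_induct)
    case (less i)
    have t: "t !! i = (if i < length x then x ! i else t !! (i - length x))"
      using assms(2) by (metis not_le shift_snth_ge shift_snth_less)
    have c: "cycle x !! i = (if i < length x then x ! i else cycle x !! (i - length x))"
      using cycle_decomp[OF assms(1)] by (metis not_le shift_snth_ge shift_snth_less)
    have "i - length x < i" if "\<not> i < length x"
      using that assms(1) by (cases x) auto
    then show ?case
      using less.IH[of "i - length x"] t c by (cases "i < length x") auto
  qed
  then show ?thesis
    by (metis smap_alt stream.map_id)
qed

lemma lex_le_antisym:
  assumes "lex_le a b" "lex_le b a"
  shows "a = b"
proof (rule ccontr)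
  assume "a \<noteq> b"
  then obtain i j where i: "stake i a = stake i b" "a !! i < b !! i"
    and j: "stake j b = stake j a" "b !! j < a !! j"
    using assms by (auto simp: lex_le_def)
  have nth: "u !! k = v !! k" if "stake m u = stake m v" "k < m" for u v :: "nat stream" and k m
    using that by (metis stake_nth)
  from i j nth[of i a b j] nth[of j b a i] show False
    by (cases i j rule: linorder_cases) auto
qed

lemma lex_le_if_first_difference_less:
  assumes "\<And>m. stake m a = stake m b \<Longrightarrow> a !! m \<noteq> b !! m \<Longrightarrow> a !! m < b !! m"
  shows "lex_le a b"
proof (cases "a = b")
  case False
  then have "\<exists>m. a !! m \<noteq> b !! m"
    by (metis smap_alt stream.map_id)
  define m where "m = (LEAST m. a !! m \<noteq> b !! m)"
  have "a !! m \<noteq> b !! m"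
    unfolding m_def by (rule LeastI_ex) fact
  moreover have "stake m a = stake m b"
    by (rule nth_equalityI) (use not_less_Least m_def in \<open>auto simp: stake_nth\<close>)
  ultimately show ?thesis
    using assms by (auto simp: lex_le_def)
qed (simp add: lex_le_def)

section \<open>Word maps of a planar iterated function system\<close>

lemma word_map_Nil [simp]: "word_map T [] z = z"
  by (simp add: word_map_def)

lemma word_map_Cons [simp]: "word_map T (k # a) z = T k (word_map T a z)"
  by (simp add: word_map_def)

lemma word_map_append: "word_map T (a @ b) z = word_map T a (word_map T b z)"
  by (induction a) auto

lemma cis_minus_address_value: "cis (- address_value \<theta> a) = cis (- (\<Sum>k\<leftarrow>a. \<theta> k))"
proof -
  let ?s = "\<Sum>k\<leftarrow>a. \<theta> k"
  have "[?s rmod (2 * pi) = ?s] (rmod (2 * pi))"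
    by (simp add: rcong_def)
  then obtain m where m: "?s = ?s rmod (2 * pi) + of_int m * (2 * pi)"
    by (auto simp: rcong_altdef)
  have "cis (- ?s) = cis (- (?s rmod (2 * pi))) * cis (2 * pi * of_int (- m))"
    by (subst m) (simp add: cis_mult algebra_simps)
  also have "cis (2 * pi * of_int (- m)) = 1"
    by (rule cis_multiple_2pi) auto
  finally show ?thesis
    by (simp add: address_value_def)
qed

locale planar_ifs =
  fixes n :: nat and p :: "nat \<Rightarrow> complex" and l \<theta> :: "nat \<Rightarrow> real"
    and T :: "nat \<Rightarrow> complex \<Rightarrow> complex"
  assumes n_pos: "n \<ge> 1"
    and ratio: "k \<in> {1..n} \<Longrightarrow> l k \<in> {0<..<1}"
    and T_eq: "k \<in> {1..n} \<Longrightarrow> T k z = p k + of_real (l k) * cis (\<theta> k) * (z - p k)"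
begin

definition factor :: "nat list \<Rightarrow> real" where
  "factor a = (\<Prod>k\<leftarrow>a. l k)"

definition angle :: "nat list \<Rightarrow> real" where
  "angle a = (\<Sum>k\<leftarrow>a. \<theta> k)"

definition max_ratio :: real where
  "max_ratio = Max (l ` {1..n})"

lemma max_ratio: "0 < max_ratio" "max_ratio < 1"
  and ratio_le_max_ratio: "k \<in> {1..n} \<Longrightarrow> l k \<le> max_ratio"
proof -
  have fin: "finite (l ` {1..n})" "l ` {1..n} \<noteq> {}"
    using n_pos by auto
  then have "max_ratio \<in> l ` {1..n}"
    unfolding max_ratio_def by (rule Max_in)
  then show "0 < max_ratio" "max_ratio < 1"
    using ratio by auto
  show "k \<in> {1..n} \<Longrightarrow> l k \<le> max_ratio"
    unfolding max_ratio_def using fin by auto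
qed

lemma factor_pos: "a \<in> lists {1..n} \<Longrightarrow> factor a > 0"
  by (induction a) (use ratio in \<open>auto simp: factor_def\<close>)

lemma factor_le: "a \<in> lists {1..n} \<Longrightarrow> factor a \<le> max_ratio ^ length a"
proof (induction a)
  case (Cons k a)
  then show ?case
    using factor_pos[of a] ratio[of k] ratio_le_max_ratio[of k] max_ratio
    by (auto simp: factor_def intro!: mult_mono)
qed (simp add: factor_def)

lemma factor_less_1:
  assumes "a \<in> lists {1..n}" "a \<noteq> []"
  shows "factor a < 1"
proof -
  have "factor a \<le> max_ratio ^ length a"
    by (rule factor_le) fact
  also have "\<dots> < 1"
    using max_ratio assms(2) by (simp add: power_less_one_iff)
  finally show ?thesis .
qed

lemma word_map_diff:
  assumes "a \<in> lists {1..n}"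
  shows "word_map T a z - word_map T a w = of_real (factor a) * cis (angle a) * (z - w)"
  using assms
proof (induction a)
  case (Cons k a)
  then have k: "k \<in> {1..n}" and IH: "word_map T a z - word_map T a w =
      of_real (factor a) * cis (angle a) * (z - w)"
    by auto
  have "word_map T (k # a) z - word_map T (k # a) w
      = of_real (l k) * cis (\<theta> k) * (word_map T a z - word_map T a w)"
    using k by (simp add: T_eq algebra_simps)
  then show ?case
    unfolding IH by (simp add: factor_def angle_def cis_mult[symmetric])
qed (simp add: factor_def angle_def)

lemma word_map_affine:
  assumes "a \<in> lists {1..n}"
  shows "word_map T a z = of_real (factor a) * cis (angle a) * z + word_map T a 0"
  using word_map_diff[OF assms, of z 0] by (simp add: algebra_simps)

lemma word_map_inj:
  assumes "a \<in> lists {1..n}"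
  shows "inj (word_map T a)"
proof (rule injI)
  fix z w assume "word_map T a z = word_map T a w"
  with word_map_diff[OF assms, of z w] factor_pos[OF assms] show "z = w"
    by auto
qed

lemma T_inj: "k \<in> {1..n} \<Longrightarrow> inj (T k)"
  using word_map_inj[of "[k]"] by (auto simp: inj_def)

lemma dist_word_map:
  assumes "a \<in> lists {1..n}"
  shows "dist (word_map T a z) (word_map T a w) = factor a * dist z w"
  using word_map_diff[OF assms, of z w] factor_pos[OF assms] by (simp add: dist_norm norm_mult)

lemma continuous_word_map: "a \<in> lists {1..n} \<Longrightarrow> continuous_on S (word_map T a)"
  by (subst continuous_on_cong[OF refl word_map_affine]) (auto intro!: continuous_intros)

lemma continuous_T: "k \<in> {1..n} \<Longrightarrow> continuous_on S (T k)"
  by (subst continuous_on_cong[OF refl T_eq]) (auto intro!: continuous_intros)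

lemma word_fixed_point_eqI:
  assumes "x \<in> lists {1..n}" "x \<noteq> []" "word_map T x w = w"
  shows "word_fixed_point T x = w"
  unfolding word_fixed_point_def
proof (rule the_equality)
  fix z assume "word_map T x z = z"
  with dist_word_map[OF assms(1), of z w] assms factor_less_1[of x] show "z = w"
    by auto
qed (fact assms(3))

end

section \<open>Points of addresses\<close>

locale ifs_attractor = planar_ifs +
  fixes F :: "complex set"
  assumes F_nonempty: "F \<noteq> {}" and F_compact: "compact F"
    and F_eq: "F = (\<Union>k\<in>{1..n}. T k ` F)"
begin

lemma T_in_F: "k \<in> {1..n} \<Longrightarrow> f \<in> F \<Longrightarrow> T k f \<in> F"
  using F_eq by blast

lemma word_map_in_F: "a \<in> lists {1..n} \<Longrightarrow> f \<in> F \<Longrightarrow> word_map T a f \<in> F"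
  by (induction a) (auto simp: T_in_F)

text \<open>The pieces \<open>T\<^sub>a F\<close> for the prefixes \<open>a\<close> of an infinite address shrink geometrically, and all
  of them contain \<open>f\<close>; so every orbit \<open>T\<^sub>a z\<close> converges to \<open>f\<close>.\<close>

lemma address_point_eqI:
  assumes s: "s \<in> streams {1..n}" and f: "\<And>m. f \<in> word_map T (stake m s) ` F"
  shows "address_point T s = f"
proof -
  have lim: "(\<lambda>m. word_map T (stake m s) z) \<longlonglongrightarrow> f" for z
  proof -
    obtain B where B: "\<And>g. g \<in> F \<Longrightarrow> dist z g \<le> B"
      using compact_imp_bounded[OF F_compact] by (auto simp: bounded_any_center[of _ z])
    have "dist (word_map T (stake m s) z) f \<le> max_ratio ^ m * B" for m
    proof -
      obtain g where g: "g \<in> F" "f = word_map T (stake m s) g"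
        using f by blast
      have "dist (word_map T (stake m s) z) f = factor (stake m s) * dist z g"
        unfolding g(2) by (rule dist_word_map) (rule stake_in_lists[OF s])
      also have "\<dots> \<le> max_ratio ^ m * B"
        using factor_le[OF stake_in_lists[OF s], of m] B[OF g(1)] max_ratio
        by (intro mult_mono) auto
      finally show ?thesis .
    qed
    moreover have "(\<lambda>m. max_ratio ^ m * B) \<longlonglongrightarrow> 0"
      using max_ratio by (intro tendsto_mult_left_zero LIMSEQ_power_zero) auto
    ultimately show ?thesis
      unfolding tendsto_dist_iff[of _ f]
      by (intro Lim_null_comparison[of "\<lambda>m. dist (word_map T (stake m s) z) f"] always_eventually) auto
  qed
  then show ?thesis
    unfolding address_point_def by (auto intro: LIMSEQ_unique)
qed

lemma ex_address_point:
  assumes s: "s \<in> streams {1..n}"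
  shows "\<exists>f. \<forall>m. f \<in> word_map T (stake m s) ` F"
proof -
  let ?K = "\<lambda>m. word_map T (stake m s) ` F"
  have "\<Inter>(range ?K) \<noteq> {}"
  proof (rule compact_nest)
    show "compact (?K m)" for m
      using s by (intro compact_continuous_image continuous_word_map F_compact stake_in_lists)
    show "?K m \<noteq> {}" for m
      using F_nonempty by simp
    have "?K (Suc m) \<subseteq> ?K m" for m
    proof -
      have "s !! m \<in> {1..n}"
        using s by (simp add: streams_iff_snth)
      then show ?thesis
        by (auto simp del: stake.simps simp: stake_Suc word_map_append intro!: T_in_F)
    qed
    then show "\<And>m k. m \<le> k \<Longrightarrow> ?K k \<subseteq> ?K m"
      using lift_Suc_antimono_le[of ?K] by blast
  qed
  then show ?thesis by auto
qed

lemma address_point_iff: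
  assumes "s \<in> streams {1..n}"
  shows "address_point T s = f \<longleftrightarrow> (\<forall>m. f \<in> word_map T (stake m s) ` F)"
  using ex_address_point[OF assms] address_point_eqI[OF assms] by metis

lemma address_point_in_F: "s \<in> streams {1..n} \<Longrightarrow> address_point T s \<in> F"
  using address_point_iff[of s "address_point T s"]
  by (metis (no_types, lifting) image_iff stake.simps(1) word_map_Nil)

lemma address_point_SCons:
  assumes "k \<in> {1..n}" "s \<in> streams {1..n}"
  shows "address_point T (k ## s) = T k (address_point T s)"
proof (rule address_point_eqI)
  show "k ## s \<in> streams {1..n}"
    using assms by (simp add: streams_Stream)
  show "T k (address_point T s) \<in> word_map T (stake m (k ## s)) ` F" for m
  proof (cases m)
    case 0
    then show ?thesis
      using T_in_F[OF assms(1) address_point_in_F[OF assms(2)]] by simp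
  next
    case (Suc m')
    have "address_point T s \<in> word_map T (stake m' s) ` F"
      using address_point_iff[OF assms(2)] by blast
    then show ?thesis
      using Suc by auto
  qed
qed

lemma address_point_shift:
  "a \<in> lists {1..n} \<Longrightarrow> s \<in> streams {1..n} \<Longrightarrow>
    address_point T (a @- s) = word_map T a (address_point T s)"
  by (induction a) (auto simp: address_point_SCons shift_streams)

lemma word_fixed_point:
  assumes "x \<in> lists {1..n}" "x \<noteq> []"
  shows "word_fixed_point T x \<in> F"
    and "word_map T x (word_fixed_point T x) = word_fixed_point T x"
proof -
  \<comment> \<open>The fixed point is the point of the periodic address.\<close>
  let ?w = "address_point T (cycle x)"
  have cyc: "cycle x \<in> streams {1..n}"
    using assms by (auto simp: streams_iff_sset)
  have "word_map T x ?w = ?w"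
    using address_point_shift[OF assms(1) cyc] cycle_decomp[OF assms(2)] by simp
  moreover from this have "word_fixed_point T x = ?w"
    using assms by (intro word_fixed_point_eqI)
  ultimately show "word_fixed_point T x \<in> F"
    "word_map T x (word_fixed_point T x) = word_fixed_point T x"
    using address_point_in_F[OF cyc] by simp_all
qed

section \<open>The lexicographically smallest address\<close>

definition first_index :: "complex \<Rightarrow> nat" where
  "first_index f = (LEAST k. k \<in> {1..n} \<and> f \<in> T k ` F)"

definition next_point :: "complex \<Rightarrow> complex" where
  "next_point f = (SOME g. g \<in> F \<and> T (first_index f) g = f)"

definition greedy_address :: "complex \<Rightarrow> nat stream" where
  "greedy_address f = smap first_index (siterate next_point f)"

lemma greedy_address_unfold: "greedy_address f = first_index f ## greedy_address (next_point f)"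
  unfolding greedy_address_def by (subst siterate.code) simp

lemma greedy_step:
  assumes "f \<in> F"
  shows "first_index f \<in> {1..n}" "next_point f \<in> F" "T (first_index f) (next_point f) = f"
proof -
  have "\<exists>k. k \<in> {1..n} \<and> f \<in> T k ` F"
    using assms F_eq by blast
  then have *: "first_index f \<in> {1..n} \<and> f \<in> T (first_index f) ` F"
    unfolding first_index_def by (rule LeastI_ex)
  then have "\<exists>g. g \<in> F \<and> T (first_index f) g = f"
    by auto
  then have "next_point f \<in> F \<and> T (first_index f) (next_point f) = f"
    unfolding next_point_def by (rule someI_ex)
  with * show "first_index f \<in> {1..n}" "next_point f \<in> F" "T (first_index f) (next_point f) = f"
    by auto
qed

lemma first_index_le: "k \<in> {1..n} \<Longrightarrow> g \<in> F \<Longrightarrow> first_index (T k g) \<le> k"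
  unfolding first_index_def by (rule Least_le) auto

lemma greedy_address_in_streams: "f \<in> F \<Longrightarrow> greedy_address f \<in> streams {1..n}"
proof (coinduction arbitrary: f)
  case streams
  then show ?case
    using greedy_step[of f] greedy_address_unfold[of f] by auto
qed

lemma address_point_greedy_address:
  assumes "f \<in> F"
  shows "address_point T (greedy_address f) = f"
proof (rule address_point_eqI)
  show "f \<in> word_map T (stake m (greedy_address f)) ` F" for m
    using assms
  proof (induction m arbitrary: f)
    case (Suc m)
    have "T (first_index f) (next_point f) \<in>
        T (first_index f) ` word_map T (stake m (greedy_address (next_point f))) ` F"
      by (intro imageI Suc.IH greedy_step Suc.prems)
    then show ?case
      by (subst greedy_address_unfold) (simp add: greedy_step[OF Suc.prems] image_image)
  qed simp
qed (use assms greedy_address_in_streams in auto)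

text \<open>As long as two addresses of a point agree, injectivity of the maps makes their tails
  addresses of the same point. At the first difference, the greedy choice is the smaller one.\<close>

lemma greedy_address_less_at_first_difference:
  assumes "f \<in> F" "b \<in> streams {1..n}" "address_point T b = f"
    and "stake m (greedy_address f) = stake m b" "greedy_address f !! m \<noteq> b !! m"
  shows "greedy_address f !! m < b !! m"
  using assms
proof (induction m arbitrary: f b)
  case (0 f b)
  obtain k s where b: "b = k ## s" by (cases b)
  then have "k \<in> {1..n}" "s \<in> streams {1..n}"
    using 0 by (auto simp: streams_Stream)
  then have "first_index f \<le> k"
    using 0 b first_index_le address_point_in_F by (auto simp: address_point_SCons)
  then show ?case
    using 0 b greedy_address_unfold[of f] by (metis le_neq_implies_less snth.simps(1) stream.sel(1))
next
  case (Suc m f b)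
  obtain k s where b: "b = k ## s" by (cases b)
  then have ks: "k \<in> {1..n}" "s \<in> streams {1..n}"
    using Suc.prems by (auto simp: streams_Stream)
  have g: "greedy_address f = first_index f ## greedy_address (next_point f)"
    by (rule greedy_address_unfold)
  have k: "k = first_index f"
    using Suc.prems(4) b g by simp
  have "T k (address_point T s) = T k (next_point f)"
    using Suc.prems b ks k greedy_step[of f] by (simp add: address_point_SCons)
  then have "address_point T s = next_point f"
    using T_inj[OF ks(1)] by (auto dest: injD)
  then have "greedy_address (next_point f) !! m < s !! m"
    using Suc.prems b g ks by (intro Suc.IH) (auto simp: greedy_step)
  then show ?case
    using b g by simp
qed

lemma adr_eq_greedy_address:
  assumes "f \<in> F"
  shows "adr n T f = greedy_address f"
  unfolding adr_def
proof (rule the_equality)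
  have min: "lex_le (greedy_address f) b" if "b \<in> streams {1..n}" "address_point T b = f" for b
    using greedy_address_less_at_first_difference[OF assms that]
    by (intro lex_le_if_first_difference_less)
  show *: "greedy_address f \<in> streams {1..n} \<and> address_point T (greedy_address f) = f \<and>
      (\<forall>b\<in>streams {1..n}. address_point T b = f \<longrightarrow> lex_le (greedy_address f) b)"
    using min greedy_address_in_streams[OF assms] address_point_greedy_address[OF assms] by blast
  show "a = greedy_address f"
    if "a \<in> streams {1..n} \<and> address_point T a = f \<and>
      (\<forall>b\<in>streams {1..n}. address_point T b = f \<longrightarrow> lex_le a b)" for a
    using that * by (intro lex_le_antisym) auto
qed

text \<open>The greedy construction makes a tail of a smallest address the smallest address of
  the point that it describes.\<close>

lemma adr_shiftD:
  assumes "f \<in> F" "adr n T f = a @- t"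
  shows "\<exists>g\<in>F. f = word_map T a g \<and> adr n T g = t"
  using assms
proof (induction a arbitrary: f)
  case (Cons k a)
  have "first_index f ## greedy_address (next_point f) = k ## (a @- t)"
    using Cons.prems by (simp add: adr_eq_greedy_address greedy_address_unfold[symmetric])
  then have k: "first_index f = k" and t: "adr n T (next_point f) = a @- t"
    using greedy_step[OF Cons.prems(1)] by (auto simp: adr_eq_greedy_address)
  from Cons.IH[OF greedy_step(2)[OF Cons.prems(1)] t]
  obtain g where "g \<in> F" "next_point f = word_map T a g" "adr n T g = t"
    by blast
  then show ?case
    using greedy_step(3)[OF Cons.prems(1)] k by auto
qed auto

lemma F_eq_address_points: "F = address_point T ` streams {1..n}"
proof
  show "F \<subseteq> address_point T ` streams {1..n}"
    by (metis address_point_greedy_address greedy_address_in_streams image_eqI subsetI)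
qed (auto intro: address_point_in_F)

section \<open>Extremal points whose address has a given prefix\<close>

lemma maximizers_with_prefix:
  assumes a: "a \<in> lists {1..n}"
    and pre: "\<And>f. f \<in> maximizers F \<tau> \<Longrightarrow> address_prefix a (adr n T f)"
  shows "maximizers F \<tau> = word_map T a ` maximizers F (cis (- address_value \<theta> a) * \<tau>)"
proof -
  define c where "c = of_real (factor a) * cis (angle a)"
  have T_a: "word_map T a = (\<lambda>z. c * z + word_map T a 0)"
    unfolding c_def by (rule ext) (rule word_map_affine[OF a])
  have c: "c \<noteq> 0" "cnj c = of_real (factor a) * cis (- address_value \<theta> a)"
    using factor_pos[OF a]
    by (auto simp: c_def cis_minus_address_value cis_cnj angle_def)
  have "maximizers F \<tau> \<subseteq> word_map T a ` F"
  proof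
    fix f assume f: "f \<in> maximizers F \<tau>"
    then obtain t where "adr n T f = a @- t"
      using pre by (auto simp: address_prefix_def)
    then show "f \<in> word_map T a ` F"
      using f maximizers_subset[of F \<tau>] adr_shiftD[of f a t] by auto
  qed
  then have "maximizers F \<tau> = maximizers (word_map T a ` F) \<tau>"
    using F_compact F_nonempty word_map_in_F[OF a]
    by (intro maximizers_subset_eq[symmetric]) auto
  also have "\<dots> = word_map T a ` maximizers F (cnj c * \<tau>)"
    using maximizers_affine_image[OF c(1)] T_a by metis
  also have "maximizers F (cnj c * \<tau>) = maximizers F (cis (- address_value \<theta> a) * \<tau>)"
    using maximizers_scale[OF factor_pos[OF a]] by (simp add: c(2) mult.assoc)
  finally show ?thesis .
qed

text \<open>When \<open>x\<close> has value zero, \<open>T\<^sub>x\<close> pulls \<open>g\<close> along a straight segment towards its fixed point. An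
  extreme point is not in the interior of the \<open>T\<^sub>b\<close>-image of that segment, so the segment
  is degenerate.\<close>

lemma extreme_point_with_untwisted_prefix:
  assumes b: "b \<in> lists {1..n}" and x: "x \<in> lists {1..n}" "x \<noteq> []" "address_value \<theta> x = 0"
    and g: "g \<in> F" and e: "word_map T b (word_map T x g) \<in> Ext F"
  shows "g = word_fixed_point T x"
proof (rule ccontr)
  assume neq: "g \<noteq> word_fixed_point T x"
  define q where "q = word_fixed_point T x"
  define r where "r = factor x"
  have q: "q \<in> F" "word_map T x q = q"
    unfolding q_def using word_fixed_point[OF x(1,2)] by auto
  have r: "0 < r" "r < 1"
    unfolding r_def using factor_pos factor_less_1 x by auto
  have "cis (- angle x) = 1"
    using cis_minus_address_value[of \<theta> x] x(3) by (simp add: angle_def)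
  then have "cis (angle x) = 1"
    by (metis cis_inverse inverse_1 minus_minus)
  then have "word_map T x g - q = of_real r * (g - q)"
    using word_map_diff[OF x(1), of g q] q(2) by (simp add: r_def)
  then have "word_map T b (word_map T x g) - word_map T b q
      = of_real r * (word_map T b g - word_map T b q)"
    by (simp add: word_map_diff[OF b])
  then have "word_map T b (word_map T x g)
      = (1 - r) *\<^sub>R word_map T b q + r *\<^sub>R word_map T b g"
    by (simp add: scaleR_conv_of_real algebra_simps)
  moreover have "word_map T b q \<noteq> word_map T b g"
    using neq word_map_inj[OF b] by (auto simp: q_def inj_eq)
  ultimately have "word_map T b (word_map T x g) \<in> open_segment (word_map T b q) (word_map T b g)"
    using r by (auto simp: in_segment)
  moreover have "word_map T b q \<in> convex hull F" "word_map T b g \<in> convex hull F"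
    using q(1) g word_map_in_F[OF b] by (auto intro: hull_inc)
  ultimately show False
    using e by (auto simp: Ext_def extreme_point_of_def)
qed

text \<open>The suffixes of the address of \<open>e\<close> after \<open>b\<close> and after \<open>bx\<close> are both the address of the same
  fixed point.\<close>

lemma Ext_with_untwisted_prefix:
  assumes b: "b \<in> lists {1..n}" and x: "x \<in> lists {1..n}" "x \<noteq> []" "address_value \<theta> x = 0"
    and e: "e \<in> Ext F" "address_prefix (b @ x) (adr n T e)"
  shows "e = word_map T b (word_fixed_point T x)" "adr n T e = b @- cycle x"
proof -
  obtain t where t: "adr n T e = b @- (x @- t)"
    using e(2) by (auto simp: address_prefix_def)
  have "e \<in> F"
    using e(1) Ext_subset by blast
  then obtain h where h: "h \<in> F" "e = word_map T b h" "adr n T h = x @- t"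
    using adr_shiftD t by blast
  then obtain g where g: "g \<in> F" "h = word_map T x g" "adr n T g = t"
    using adr_shiftD by blast
  have "g = word_fixed_point T x"
    using e(1) h(2) g by (intro extreme_point_with_untwisted_prefix[OF b x]) auto
  then have "h = g" and q: "h = word_fixed_point T x"
    using g(2) word_fixed_point(2)[OF x(1,2)] by auto
  then have "t = x @- t"
    using h(3) g(3) by simp
  then have "t = cycle x"
    by (rule periodic_stream_eq_cycle[OF x(2)])
  then show "adr n T e = b @- cycle x"
    using t cycle_decomp[OF x(2)] by simp
  show "e = word_map T b (word_fixed_point T x)"
    using h(2) q by simp
qed

lemma maximizers_with_untwisted_prefix:
  assumes "b \<in> lists {1..n}" "x \<in> lists {1..n}" "x \<noteq> []" "address_value \<theta> x = 0"
    and "\<And>f. f \<in> maximizers F \<tau> \<Longrightarrow> address_prefix (b @ x) (adr n T f)"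
  shows "maximizers F \<tau> = {word_map T b (word_fixed_point T x)}"
proof -
  have "f = word_map T b (word_fixed_point T x)" if "f \<in> maximizers F \<tau>" for f
    using that assms by (intro Ext_with_untwisted_prefix(1)) (auto simp: maximizers_def)
  then show ?thesis
    using maximizers_nonempty[OF F_compact F_nonempty, of \<tau>] by blast
qed

end

section \<open>Existence and uniqueness of the fractal\<close>

context planar_ifs
begin

text \<open>A large ball \<open>B\<close> is mapped into itself by all maps, so the iterates of the Hutchinson operator
  on \<open>B\<close> are nested, and their intersection is invariant.\<close>

lemma ex_attractor: "\<exists>F. ifs_attractor n p l \<theta> T F"
proof -
  define R where "R = (\<Sum>k\<in>{1..n}. norm (T k 0) / (1 - l k))"
  define S where "S A = (\<Union>k\<in>{1..n}. T k ` A)" for A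
  define K where "K m = (S ^^ m) (cball 0 R)" for m
  have K_Suc: "K (Suc m) = S (K m)" for m
    by (simp add: K_def)
  have S_mono: "S A \<subseteq> S B" if "A \<subseteq> B" for A B
    using that by (auto simp: S_def)
  have nonneg: "0 \<le> norm (T k 0) / (1 - l k)" if "k \<in> {1..n}" for k
    using ratio[OF that] by simp
  then have "R \<ge> 0"
    unfolding R_def by (rule sum_nonneg)
  have S_ball: "S (cball 0 R) \<subseteq> cball 0 R"
  proof -
    have "norm (T k z) \<le> R" if k: "k \<in> {1..n}" and z: "norm z \<le> R" for k z
    proof -
      have lk: "0 < l k" "l k < 1"
        using ratio[OF k] by auto
      have "norm (T k 0) / (1 - l k) \<le> R"
        unfolding R_def using k nonneg by (intro member_le_sum) auto
      then have "norm (T k 0) \<le> R * (1 - l k)"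
        using lk by (simp add: field_simps)
      moreover have "T k z = T k 0 + of_real (l k) * cis (\<theta> k) * z"
        using k by (simp add: T_eq algebra_simps)
      then have "norm (T k z) \<le> norm (T k 0) + l k * norm z"
        using lk norm_triangle_ineq[of "T k 0" "of_real (l k) * cis (\<theta> k) * z"]
        by (simp add: norm_mult)
      moreover have "l k * norm z \<le> l k * R"
        using lk z by (intro mult_left_mono) auto
      ultimately show ?thesis
        by (simp add: algebra_simps)
    qed
    then show ?thesis
      by (auto simp: S_def)
  qed
  have K_decreasing: "K (Suc m) \<subseteq> K m" for m
  proof (induction m)
    case (Suc m)
    then show ?case unfolding K_Suc[of "Suc m"] K_Suc[of m] by (rule S_mono)
  qed (use S_ball in \<open>simp add: K_def\<close>)
  have K_anti: "K k \<subseteq> K m" if "m \<le> k" for m k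
    using lift_Suc_antimono_le[of K, OF K_decreasing that] .
  have K_compact: "compact (K m)" for m
  proof (induction m)
    case (Suc m)
    then show ?case
      unfolding K_Suc S_def by (intro compact_UN compact_continuous_image continuous_T) auto
  qed (simp add: K_def)
  have K_nonempty: "K m \<noteq> {}" for m
  proof (induction m)
    case (Suc m)
    then show ?case using n_pos by (auto simp: K_Suc S_def)
  qed (use \<open>R \<ge> 0\<close> in \<open>simp add: K_def\<close>)
  define F where "F = \<Inter>(range K)"
  have "F \<noteq> {}"
    unfolding F_def by (rule compact_nest) (use K_compact K_nonempty K_anti in auto)
  have "compact F"
    unfolding F_def using K_compact by (intro compact_Inter) auto
  have "S F \<subseteq> F"
  proof -
    have "S F \<subseteq> K m" for m
    proof -
      have "S F \<subseteq> K (Suc m)"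
        unfolding K_Suc by (rule S_mono) (auto simp: F_def)
      then show ?thesis using K_anti[of m "Suc m"] by auto
    qed
    then show ?thesis by (auto simp: F_def)
  qed
  moreover have "F \<subseteq> S F"
  proof
    fix z assume "z \<in> F"
    then have "z \<in> S (K m)" for m
      unfolding F_def K_Suc[symmetric] by auto
    then have "\<forall>m. \<exists>k\<in>{1..n}. z \<in> T k ` K m"
      by (auto simp: S_def)
    \<comment> \<open>Otherwise each of the finitely many indices fails from some stage on, as the sets are nested.\<close>
    have "\<exists>k\<in>{1..n}. \<forall>m. z \<in> T k ` K m"
    proof (rule ccontr)
      assume "\<not> ?thesis"
      then obtain M where M: "\<And>k. k \<in> {1..n} \<Longrightarrow> z \<notin> T k ` K (M k)"
        by metis
      define m where "m = Max (M ` {1..n})"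
      obtain k where k: "k \<in> {1..n}" "z \<in> T k ` K m"
        using \<open>\<forall>m. \<exists>k\<in>{1..n}. z \<in> T k ` K m\<close> by blast
      have "M k \<le> m"
        unfolding m_def using k(1) by (intro Max_ge) auto
      then show False
        using M[OF k(1)] k(2) K_anti by blast
    qed
    then obtain k where k: "k \<in> {1..n}" "\<And>m. z \<in> T k ` K m"
      by blast
    have "T k ` (\<Inter>(range K)) = (\<Inter>m. T k ` K m)"
      using image_INT[of "T k" UNIV UNIV K 0] T_inj[OF k(1)] by auto
    with k(2) have "z \<in> T k ` F"
      unfolding F_def by blast
    with k(1) show "z \<in> S F"
      unfolding S_def by blast
  qed
  ultimately have "ifs_attractor n p l \<theta> T F"
    using \<open>F \<noteq> {}\<close> \<open>compact F\<close> by unfold_locales (auto simp: S_def)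
  then show ?thesis ..
qed

lemma attractor_ifs_fractal: "ifs_attractor n p l \<theta> T (ifs_fractal n T)"
proof -
  obtain F where F: "ifs_attractor n p l \<theta> T F"
    using ex_attractor ..
  then interpret ifs_attractor n p l \<theta> T F .
  have "ifs_fractal n T = F"
    unfolding ifs_fractal_def
  proof (rule the_equality)
    show "F \<noteq> {} \<and> compact F \<and> F = (\<Union>k\<in>{1..n}. T k ` F)"
      by (intro conjI F_nonempty F_compact F_eq)
    fix G assume G: "G \<noteq> {} \<and> compact G \<and> G = (\<Union>k\<in>{1..n}. T k ` G)"
    then have "ifs_attractor n p l \<theta> T G"
      by (intro ifs_attractor.intro ifs_attractor_axioms.intro planar_ifs_axioms) (elim conjE, assumption)+
    then have "G = address_point T ` streams {1..n}"
      by (rule ifs_attractor.F_eq_address_points)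
    then show "G = F"
      using F_eq_address_points by simp
  qed
  with F show ?thesis by simp
qed

end

theorem theorem2p2:
  fixes n :: nat
    and p \<phi> :: "nat \<Rightarrow> complex"
    and l \<theta> :: "nat \<Rightarrow> real"
    and T :: "nat \<Rightarrow> complex \<Rightarrow> complex"
    and F :: "complex set"
    and \<tau> :: complex
  assumes "n \<ge> 1"
    and "\<And>k. k \<in> {1..n} \<Longrightarrow> l k \<in> {0<..<1}"
    and "\<And>k. k \<in> {1..n} \<Longrightarrow> \<theta> k \<in> {-pi<..pi}"
    and "\<And>k. k \<in> {1..n} \<Longrightarrow> \<phi> k = complex_of_real (l k) * cis (\<theta> k)"
    and "\<And>k z. k \<in> {1..n} \<Longrightarrow> T k z = p k + \<phi> k * (z - p k)"
    and "F = ifs_fractal n T"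
    and "\<tau> \<noteq> 0"
  shows "(\<forall>a\<in>lists {1..n}.
            (\<forall>f\<in>maximizers F \<tau>. address_prefix a (adr n T f)) \<longrightarrow>
            maximizers F \<tau> = word_map T a ` maximizers F (cis (- address_value \<theta> a) * \<tau>))
       \<and> (\<forall>b\<in>lists {1..n}. \<forall>x\<in>lists {1..n}.
            (\<forall>f\<in>maximizers F \<tau>. address_prefix (b @ x) (adr n T f)) \<and>
            address_value \<theta> x = 0 \<and> x \<noteq> [] \<longrightarrow>
            maximizers F \<tau> = {word_map T b (word_fixed_point T x)})
       \<and> (\<forall>e\<in>Ext F. \<forall>b\<in>lists {1..n}. \<forall>x\<in>lists {1..n}.
            address_prefix (b @ x) (adr n T e) \<and> address_value \<theta> x = 0 \<and> x \<noteq> [] \<longrightarrow>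
            adr n T e = b @- cycle x)"
proof -
  interpret planar_ifs n p l \<theta> T
    using assms by unfold_locales auto
  interpret ifs_attractor n p l \<theta> T F
    unfolding assms(6) by (rule attractor_ifs_fractal)
  show ?thesis
  proof (intro conjI ballI impI)
    fix a assume "a \<in> lists {1..n}" "\<forall>f\<in>maximizers F \<tau>. address_prefix a (adr n T f)"
    then show "maximizers F \<tau> = word_map T a ` maximizers F (cis (- address_value \<theta> a) * \<tau>)"
      by (intro maximizers_with_prefix) auto
  next
    fix b x assume "b \<in> lists {1..n}" "x \<in> lists {1..n}"
      "(\<forall>f\<in>maximizers F \<tau>. address_prefix (b @ x) (adr n T f)) \<and> address_value \<theta> x = 0 \<and> x \<noteq> []"
    then show "maximizers F \<tau> = {word_map T b (word_fixed_point T x)}"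
      by (intro maximizers_with_untwisted_prefix) auto
  next
    fix e b x assume "e \<in> Ext F" "b \<in> lists {1..n}" "x \<in> lists {1..n}"
      "address_prefix (b @ x) (adr n T e) \<and> address_value \<theta> x = 0 \<and> x \<noteq> []"
    then show "adr n T e = b @- cycle x"
      by (intro Ext_with_untwisted_prefix(2)) auto
  qed
qed

end
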